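(* A topological lop $X$ satisfying the separation axiom $T_0$ has a countable Pytkeev network if and only if $X$ is a separable space with the strong Pytkeev property.
   Context: A lop is a set $X$ endowed with a binary operation $X\times X\to X$, $(x,y)\mapsto xy$, that has a unit $e\in X$ (i.e. $xe=x=ex$ for all $x\in X$) and such that for every $a\in X$ the left shift $L_a:X\to X$, $L_a(x)=ax$, is bijective (associativity is not assumed). The division operation is $q:X\times X\to X$, $q(x,y)=x^{-1}y:=L_x^{-1}(y)$. A topological lop is a lop endowed with a topology such that both the multiplication $(x,y)\mapsto xy$ and the division $(x,y)\mapsto x^{-1}y$ are continuous as maps $X\times X\to X$. A subset $A$ of a topological space $X$ accumulates at a point $x\in X$ if each neighborhood of $x$ contains infinitely many points of $A$. A family $\mathcal N$ of subsets of $X$ is a network at $x\in X$ if for any neighborhood $O_x$ of $x$ there is $N\in\mathcal N$ with $x\in N\subset O_x$. It is a Pytkeev network at $x$ if it is a network at $x$ and for each neighborhood $O_x$ of $x$ and each subset $A\subset X$ accumulating at $x$ there is $N\in\mathcal N$ such that $N\subset O_x$ and $N\cap A$ is infinite. It is a Pytkeev network for $X$ if it is a Pytkeev network at each point $x\in X$. A topological space $X$ has the strong Pytkeev property if $X$ has a countable Pytkeev network at each point $x\in X$. *)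

theory Defs
  imports "HOL-Analysis.Analysis"
begin

definition lop :: "'a set \<Rightarrow> ('a \<Rightarrow> 'a \<Rightarrow> 'a) \<Rightarrow> bool" where
  "lop S mul \<longleftrightarrow>
     (\<forall>x\<in>S. \<forall>y\<in>S. mul x y \<in> S) \<and>
     (\<exists>e\<in>S. \<forall>x\<in>S. mul x e = x \<and> mul e x = x) \<and>
     (\<forall>a\<in>S. bij_betw (mul a) S S)"

text \<open>The inverse is that of the left shift restricted to the carrier;
  the values of \<open>mul\<close> outside the carrier are irrelevant.\<close>

definition lop_div :: "'a set \<Rightarrow> ('a \<Rightarrow> 'a \<Rightarrow> 'a) \<Rightarrow> 'a \<Rightarrow> 'a \<Rightarrow> 'a" where
  "lop_div S mul x y = inv_into S (mul x) y"

definition topological_lop :: "'a topology \<Rightarrow> ('a \<Rightarrow> 'a \<Rightarrow> 'a) \<Rightarrow> bool" where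
  "topological_lop X mul \<longleftrightarrow>
     lop (topspace X) mul \<and>
     continuous_map (prod_topology X X) X (\<lambda>(x, y). mul x y) \<and>
     continuous_map (prod_topology X X) X (\<lambda>(x, y). lop_div (topspace X) mul x y)"

text \<open>Neighborhoods are not required to be open.\<close>

definition neighborhood_at :: "'a topology \<Rightarrow> 'a \<Rightarrow> 'a set \<Rightarrow> bool" where
  "neighborhood_at X x V \<longleftrightarrow> V \<subseteq> topspace X \<and> (\<exists>U. openin X U \<and> x \<in> U \<and> U \<subseteq> V)"

definition accumulates_at :: "'a topology \<Rightarrow> 'a set \<Rightarrow> 'a \<Rightarrow> bool" where
  "accumulates_at X A x \<longleftrightarrow> (\<forall>V. neighborhood_at X x V \<longrightarrow> infinite (V \<inter> A))"

definition network_at :: "'a topology \<Rightarrow> 'a \<Rightarrow> 'a set set \<Rightarrow> bool" where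
  "network_at X x \<N> \<longleftrightarrow>
     \<N> \<subseteq> Pow (topspace X) \<and>
     (\<forall>V. neighborhood_at X x V \<longrightarrow> (\<exists>N\<in>\<N>. x \<in> N \<and> N \<subseteq> V))"

definition Pytkeev_network_at :: "'a topology \<Rightarrow> 'a \<Rightarrow> 'a set set \<Rightarrow> bool" where
  "Pytkeev_network_at X x \<N> \<longleftrightarrow>
     network_at X x \<N> \<and>
     (\<forall>V A. neighborhood_at X x V \<longrightarrow> A \<subseteq> topspace X \<longrightarrow> accumulates_at X A x \<longrightarrow>
        (\<exists>N\<in>\<N>. N \<subseteq> V \<and> infinite (N \<inter> A)))"

definition Pytkeev_network :: "'a topology \<Rightarrow> 'a set set \<Rightarrow> bool" where
  "Pytkeev_network X \<N> \<longleftrightarrow> (\<forall>x\<in>topspace X. Pytkeev_network_at X x \<N>)"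

definition strong_Pytkeev :: "'a topology \<Rightarrow> bool" where
  "strong_Pytkeev X \<longleftrightarrow>
     (\<forall>x\<in>topspace X. \<exists>\<N>. countable \<N> \<and> Pytkeev_network_at X x \<N>)"

end

theory Submission
  imports Defs
begin

text \<open>
  A countable Pytkeev network \<open>\<N>\<close> is in particular a countable network, so one point chosen from
  each nonempty member gives a countable dense set; this settles one direction.

  For the converse, let \<open>D\<close> be a countable dense set and \<open>\<N>\<close> a countable Pytkeev network at the
  unit \<open>e\<close>. The claim is that the countably
  many translates \<open>dN\<close> with \<open>d \<in> D\<close> and \<open>N \<in> \<N>\<close> form a Pytkeev network for the whole space.
  Fix a point \<open>x\<close> and a neighborhood \<open>O\<close> of it. As \<open>xe = x\<close>, there are neighborhoods \<open>V\<close> of \<open>x\<close>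
  and \<open>U\<close> of \<open>e\<close> with \<open>VU \<subseteq> O\<close>, so \<open>dN \<subseteq> O\<close> as soon as \<open>d \<in> V\<close> and \<open>N \<subseteq> U\<close>. As \<open>x\<inverse>x = e\<close>,
  the quotient \<open>d\<inverse>a\<close> is near \<open>e\<close> when \<open>d\<close> and \<open>a\<close> are near \<open>x\<close>. Hence suitable
  sets of such quotients accumulate at \<open>e\<close>, and some \<open>N \<subseteq> U\<close> contains infinitely many of them;
  a quotient \<open>d\<inverse>a \<in> N\<close> means \<open>a \<in> dN\<close>.

  With \<open>a = x\<close> this gives a network. For a set \<open>A\<close> accumulating at \<open>x\<close>, the infinitely many
  quotients found in \<open>N\<close> could belong to different \<open>d\<close>, so that each single \<open>dN\<close> might meet \<open>A\<close>
  in a finite set only. A diagonal argument excludes this: enumerate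
  \<open>D\<close> as \<open>d\<^sub>0, d\<^sub>1, \<dots>\<close> and \<open>\<N>\<close> as \<open>N\<^sub>0, N\<^sub>1, \<dots>\<close>, and if all \<open>A \<inter> d\<^sub>nN\<^sub>m\<close> in question are finite,
  use only those quotients \<open>d\<^sub>n\<inverse>a\<close> whose \<open>a\<close> avoids \<open>d\<^sub>nN\<^sub>m\<close> for all \<open>m \<le> n\<close>. They still
  accumulate at \<open>e\<close>, but \<open>N\<^sub>m\<close> contains only quotients with \<open>n < m\<close>, of which there are finitely
  many.

  To see that a set of quotients accumulates at \<open>e\<close>, it suffices in a \<open>T\<^sub>1\<close> space that it avoids
  \<open>e\<close> and meets every neighborhood of \<open>e\<close>. Topological lops that are \<open>T\<^sub>0\<close> are \<open>T\<^sub>1\<close>, because their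
  specialization preorder is symmetric.
\<close>

section \<open>Accumulation and separability\<close>

text \<open>
  If a neighborhood of \<open>x\<close> met \<open>B\<close> in finitely many points only, removing these (a closed set
  without \<open>x\<close>) would leave a neighborhood of \<open>x\<close> that misses \<open>B\<close>.
\<close>
lemma accumulates_atI_t1:
  assumes "t1_space X" and "x \<notin> B"
    and meets: "\<And>W. openin X W \<Longrightarrow> x \<in> W \<Longrightarrow> W \<inter> B \<noteq> {}"
  shows "accumulates_at X B x"
  unfolding accumulates_at_def
proof (intro allI impI notI)
  fix V assume "neighborhood_at X x V" and fin: "finite (V \<inter> B)"
  then obtain W where W: "openin X W" "x \<in> W" "W \<subseteq> V"
    unfolding neighborhood_at_def by blast
  have "finite (W \<inter> B)"
    using fin W(3) by (meson Int_mono finite_subset order_refl)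
  moreover have "W \<inter> B \<subseteq> topspace X"
    using openin_subset[OF W(1)] by blast
  ultimately have "closedin X (W \<inter> B)"
    using \<open>t1_space X\<close> t1_space_closedin_finite by blast
  then have "openin X (W - W \<inter> B)"
    using W(1) by (rule openin_diff[rotated])
  then have "(W - W \<inter> B) \<inter> B \<noteq> {}"
    using W(2) \<open>x \<notin> B\<close> by (intro meets) auto
  then show False by blast
qed

lemma neighborhood_at_openin: "openin X U \<Longrightarrow> x \<in> U \<Longrightarrow> neighborhood_at X x U"
  unfolding neighborhood_at_def using openin_subset by blast

lemma separable_space_if_countable_network:
  assumes "countable \<N>" and net: "\<And>x. x \<in> topspace X \<Longrightarrow> network_at X x \<N>"
  shows "separable_space X"
proof -
  define D where "D = (\<lambda>N. SOME y. y \<in> N) ` {N \<in> \<N>. N \<noteq> {} \<and> N \<subseteq> topspace X}"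
  have "countable D"
    unfolding D_def using \<open>countable \<N>\<close> by (auto intro: countable_subset[of _ \<N>])
  moreover have "D \<subseteq> topspace X"
    unfolding D_def by (auto simp: some_in_eq dest!: subsetD)
  moreover have "D \<inter> T \<noteq> {}" if T: "openin X T" "T \<noteq> {}" for T
  proof -
    obtain x where x: "x \<in> T" using T(2) by blast
    then have "x \<in> topspace X" using openin_subset[OF T(1)] by blast
    then obtain N where N: "N \<in> \<N>" "x \<in> N" "N \<subseteq> T"
      using net neighborhood_at_openin[OF T(1) x] unfolding network_at_def by blast
    have "(SOME y. y \<in> N) \<in> N" using N(2) by (rule someI)
    moreover have "(SOME y. y \<in> N) \<in> D"
      unfolding D_def using N openin_subset[OF T(1)] by blast
    ultimately show ?thesis using N(3) by blast
  qed
  ultimately show ?thesis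
    unfolding separable_space_def by (metis dense_intersects_open inf_commute)
qed

section \<open>Topological lops\<close>

lemma continuous_map_prod_nhds:
  assumes cont: "continuous_map (prod_topology X Y) Z (\<lambda>(x, y). f x y)"
    and "x \<in> topspace X" "y \<in> topspace Y" and W: "openin Z W" "f x y \<in> W"
  obtains U V where "openin X U" "x \<in> U" "openin Y V" "y \<in> V"
    "\<And>u v. u \<in> U \<Longrightarrow> v \<in> V \<Longrightarrow> f u v \<in> W"
proof -
  let ?P = "{p \<in> topspace (prod_topology X Y). (\<lambda>(x, y). f x y) p \<in> W}"
  have "openin (prod_topology X Y) ?P"
    using cont W(1) by (rule openin_continuous_map_preimage)
  moreover have "(x, y) \<in> ?P" using assms by simp
  ultimately obtain U V where "openin X U" "x \<in> U" "openin Y V" "y \<in> V" "U \<times> V \<subseteq> ?P"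
    unfolding openin_prod_topology_alt by blast
  then show thesis by (intro that) auto
qed

lemma lop_div_closed:
  assumes "lop S mul" "x \<in> S" "y \<in> S"
  shows "lop_div S mul x y \<in> S"
  using assms unfolding lop_def lop_div_def by (metis bij_betw_imp_surj_on inv_into_into)

lemma lop_mul_div:
  assumes "lop S mul" "x \<in> S" "y \<in> S"
  shows "mul x (lop_div S mul x y) = y"
  using assms unfolding lop_def lop_div_def by (metis bij_betw_imp_surj_on f_inv_into_f)

lemma lop_div_mul:
  assumes "lop S mul" "x \<in> S" "y \<in> S"
  shows "lop_div S mul x (mul x y) = y"
  using assms unfolding lop_def lop_div_def by (metis bij_betw_imp_inj_on inv_into_f_f)

text \<open>
  The specialization preorder of a topological lop is symmetric: suppose that every neighborhood
  of \<open>y\<close> contains \<open>x\<close>. Applying the continuous map \<open>z \<mapsto> z\<inverse>y\<close>, every neighborhood of \<open>e\<close>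
  contains \<open>x\<inverse>y\<close>; applying the left shift by \<open>x\<close>, every neighborhood of \<open>x\<close> contains \<open>y\<close>.
\<close>
lemma topological_lop_t0_imp_t1:
  assumes tl: "topological_lop X mul" and "t0_space X"
  shows "t1_space X"
proof -
  let ?S = "topspace X"
  have lop: "lop ?S mul"
    and mul: "continuous_map (prod_topology X X) X (\<lambda>(x, y). mul x y)"
    and dv: "continuous_map (prod_topology X X) X (\<lambda>(x, y). lop_div ?S mul x y)"
    using tl unfolding topological_lop_def by auto
  obtain e where e: "e \<in> ?S" "\<And>x. x \<in> ?S \<Longrightarrow> mul x e = x"
    using lop unfolding lop_def by blast
  have sym: "\<exists>V. openin X V \<and> y \<in> V \<and> x \<notin> V"
    if xy: "x \<in> ?S" "y \<in> ?S" and W: "openin X W" "x \<in> W" "y \<notin> W" for x y W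
  proof -
    have "mul x e \<in> W" using e xy W by simp
    then obtain P Q where PQ: "x \<in> P" "openin X Q" "e \<in> Q"
        "\<And>u v. u \<in> P \<Longrightarrow> v \<in> Q \<Longrightarrow> mul u v \<in> W"
      using continuous_map_prod_nhds[OF mul xy(1) e(1) W(1)] by metis
    have "lop_div ?S mul x y \<notin> Q"
      using PQ(1,4) W(3) lop_mul_div[OF lop xy] by metis
    moreover have "lop_div ?S mul y y \<in> Q"
      using lop_div_mul[OF lop xy(2) e(1)] e(2)[OF xy(2)] PQ(3) by simp
    then obtain V V' where "openin X V" "y \<in> V" "y \<in> V'"
        "\<And>u v. u \<in> V \<Longrightarrow> v \<in> V' \<Longrightarrow> lop_div ?S mul u v \<in> Q"
      using continuous_map_prod_nhds[OF dv xy(2) xy(2) PQ(2)] by metis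
    ultimately show ?thesis by blast
  qed
  show ?thesis
    unfolding t1_space_def
  proof (intro ballI impI)
    fix x y assume xy: "x \<in> ?S" "y \<in> ?S" "x \<noteq> y"
    then obtain W where W: "openin X W" "x \<notin> W \<longleftrightarrow> y \<in> W"
      using \<open>t0_space X\<close> unfolding t0_space_def by blast
    show "\<exists>V. openin X V \<and> x \<in> V \<and> y \<notin> V"
    proof (cases "x \<in> W")
      case True
      then show ?thesis using W by blast
    next
      case False
      then show ?thesis using sym[OF xy(2,1) W(1)] W(2) by blast
    qed
  qed
qed

section \<open>Translating a Pytkeev network at the unit\<close>

text \<open>
  Only the points \<open>x \<in> D\<close> are translates of \<open>e\<close> by elements of \<open>D\<close>. At any other point \<open>x\<close> the
  traces of a set \<open>A\<close> accumulating at \<open>x\<close> are seen from \<open>e\<close> through the quotients \<open>d\<inverse>a\<close>, where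
  \<open>d\<close> has to vary along with \<open>a\<close>; the diagonal choice of these quotients is what makes one single
  \<open>d\<close> suffice in the end.
\<close>
lemma Pytkeev_network_translates:
  assumes tl: "topological_lop X mul" and t1: "t1_space X"
    and e: "e \<in> topspace X" "\<And>x. x \<in> topspace X \<Longrightarrow> mul x e = x"
    and pyt: "Pytkeev_network_at X e \<N>" and "countable \<N>"
    and "countable D" and DS: "D \<subseteq> topspace X" and dense: "X closure_of D = topspace X"
  shows "Pytkeev_network X {mul d ` N |d N. d \<in> D \<and> N \<in> \<N>}"
proof -
  let ?S = "topspace X"
  let ?q = "lop_div ?S mul"
  let ?T = "{mul d ` N |d N. d \<in> D \<and> N \<in> \<N>}"
  have lop: "lop ?S mul"
    and mul: "continuous_map (prod_topology X X) X (\<lambda>(x, y). mul x y)"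
    and dv: "continuous_map (prod_topology X X) X (\<lambda>(x, y). ?q x y)"
    using tl unfolding topological_lop_def by auto
  have NS: "N \<subseteq> ?S" if "N \<in> \<N>" for N
    using pyt that unfolding Pytkeev_network_at_def network_at_def by blast
  have net: "\<exists>N\<in>\<N>. e \<in> N \<and> N \<subseteq> U" if "openin X U" "e \<in> U" for U
    using pyt neighborhood_at_openin[OF that]
    unfolding Pytkeev_network_at_def network_at_def by blast
  have pytE: "\<exists>N\<in>\<N>. N \<subseteq> U \<and> infinite (N \<inter> B)"
    if "openin X U" "e \<in> U" "B \<subseteq> ?S" "accumulates_at X B e" for U B
    using pyt neighborhood_at_openin[OF that(1,2)] that(3,4)
    unfolding Pytkeev_network_at_def by blast
  have DT: "D \<inter> W \<noteq> {}" if "openin X W" "x \<in> W" for W x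
    using dense that unfolding dense_intersects_open by blast
  have q_self: "?q x x = e" if "x \<in> ?S" for x
    using lop_div_mul[OF lop that e(1)] e(2)[OF that] by simp
  have q_eq_e: "x = y" if "x \<in> ?S" "y \<in> ?S" "?q x y = e" for x y
    using lop_mul_div[OF lop that(1,2)] that(3) e(2)[OF that(1)] by simp
  have TS: "?T \<subseteq> Pow ?S"
    using DS NS lop unfolding lop_def by blast
  show ?thesis
    unfolding Pytkeev_network_def
  proof
    fix x assume x: "x \<in> ?S"
    \<comment> \<open>The two neighborhoods that keep translates small and quotients close to the unit.\<close>
    have small: "\<exists>V U. openin X V \<and> x \<in> V \<and> openin X U \<and> e \<in> U \<and>
        (\<forall>d N. d \<in> V \<longrightarrow> N \<subseteq> U \<longrightarrow> mul d ` N \<subseteq> Z)" if Z: "neighborhood_at X x Z" for Z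
    proof -
      obtain W where W: "openin X W" "x \<in> W" "W \<subseteq> Z"
        using Z unfolding neighborhood_at_def by blast
      then have "mul x e \<in> W" using e(2)[OF x] by simp
      then obtain V U where "openin X V" "x \<in> V" "openin X U" "e \<in> U"
          "\<And>u v. u \<in> V \<Longrightarrow> v \<in> U \<Longrightarrow> mul u v \<in> W"
        using continuous_map_prod_nhds[OF mul x e(1) W(1)] by metis
      moreover from this have "\<forall>d N. d \<in> V \<longrightarrow> N \<subseteq> U \<longrightarrow> mul d ` N \<subseteq> Z"
        using W(3) by blast
      ultimately show ?thesis by blast
    qed
    have quot: "\<exists>V. openin X V \<and> x \<in> V \<and> (\<forall>d\<in>V. \<forall>a\<in>V. ?q d a \<in> W)"
      if W: "openin X W" "e \<in> W" for W
    proof -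
      have "?q x x \<in> W" using q_self[OF x] W by simp
      then obtain P Q where "openin X P" "x \<in> P" "openin X Q" "x \<in> Q"
          "\<And>u v. u \<in> P \<Longrightarrow> v \<in> Q \<Longrightarrow> ?q u v \<in> W"
        using continuous_map_prod_nhds[OF dv x x W(1)] by metis
      then show ?thesis by (intro exI[of _ "P \<inter> Q"]) auto
    qed
    have "network_at X x ?T"
      unfolding network_at_def
    proof (intro conjI TS allI impI)
      fix Z assume "neighborhood_at X x Z"
      then obtain V U where V: "openin X V" "x \<in> V" and U: "openin X U" "e \<in> U"
        and VU: "\<And>d N. d \<in> V \<Longrightarrow> N \<subseteq> U \<Longrightarrow> mul d ` N \<subseteq> Z"
        using small by metis
      let ?B = "(\<lambda>d. ?q d x) ` (D \<inter> V)"
      \<comment> \<open>If \<open>x\<close> itself lies in \<open>D \<inter> V\<close>, then \<open>e\<close> is one of the quotients, and the network property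
        at \<open>e\<close> is enough.\<close>
      have "\<exists>d N. d \<in> D \<inter> V \<and> N \<in> \<N> \<and> N \<subseteq> U \<and> ?q d x \<in> N"
      proof (cases "e \<in> ?B")
        case True
        then show ?thesis using net[OF U] by force
      next
        case False
        have "accumulates_at X ?B e"
        proof (rule accumulates_atI_t1[OF t1 False])
          fix W assume "openin X W" "e \<in> W"
          then obtain V' where V': "openin X V'" "x \<in> V'" "\<forall>d\<in>V'. \<forall>a\<in>V'. ?q d a \<in> W"
            using quot by blast
          obtain d where "d \<in> D" "d \<in> V \<inter> V'"
            using DT[of "V \<inter> V'" x] V V' by blast
          then show "W \<inter> ?B \<noteq> {}" using V' by blast
        qed
        moreover have "?B \<subseteq> ?S" using lop_div_closed[OF lop _ x] DS by blast
        ultimately obtain N where "N \<in> \<N>" "N \<subseteq> U" "infinite (N \<inter> ?B)"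
          using pytE[OF U] by blast
        moreover from this have "N \<inter> ?B \<noteq> {}" by (metis finite.emptyI)
        ultimately show ?thesis by blast
      qed
      then obtain d N where dN: "d \<in> D" "d \<in> V" "N \<in> \<N>" "N \<subseteq> U" "?q d x \<in> N"
        by blast
      have "x \<in> mul d ` N"
        using lop_mul_div[OF lop _ x] dN DS by (metis image_eqI subsetD)
      then show "\<exists>M\<in>?T. x \<in> M \<and> M \<subseteq> Z"
        using VU dN by blast
    qed
    moreover have "\<exists>M\<in>?T. M \<subseteq> Z \<and> infinite (M \<inter> A)"
      if Z: "neighborhood_at X x Z" and AS: "A \<subseteq> ?S" and acc: "accumulates_at X A x" for Z A
    proof (rule ccontr)
      assume none: "\<not> ?thesis"
      obtain V U where V: "openin X V" "x \<in> V" and U: "openin X U" "e \<in> U"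
        and VU: "\<And>d N. d \<in> V \<Longrightarrow> N \<subseteq> U \<Longrightarrow> mul d ` N \<subseteq> Z"
        using small[OF Z] by metis
      have fin: "finite (mul d ` N \<inter> A)" if "d \<in> D" "d \<in> V" "N \<in> \<N>" "N \<subseteq> U" for d N
        using none that VU by blast
      define d where "d = from_nat_into D"
      define M where "M = from_nat_into \<N>"
      have "D \<noteq> {}" using DT[OF V] by blast
      then have d: "d n \<in> D" for n unfolding d_def by (rule from_nat_into)
      have "\<N> \<noteq> {}" using net[OF U] by blast
      then have M: "M m \<in> \<N>" for m unfolding M_def by (rule from_nat_into)
      \<comment> \<open>The diagonal choice; excluding \<open>a = d n\<close> keeps the unit out of \<open>B\<close>.\<close>
      define good where "good n a \<longleftrightarrow> d n \<in> V \<and> a \<in> A \<and> a \<noteq> d n \<and>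
          (\<forall>m\<le>n. M m \<subseteq> U \<longrightarrow> a \<notin> mul (d n) ` M m)" for n a
      define B where "B = {?q (d n) a |n a. good n a}"
      have goodS: "d n \<in> ?S" "a \<in> ?S" if "good n a" for n a
        using that d DS AS unfolding good_def by auto
      have BS: "B \<subseteq> ?S"
        unfolding B_def using lop_div_closed[OF lop] goodS by blast
      have "accumulates_at X B e"
      proof (rule accumulates_atI_t1[OF t1])
        show "e \<notin> B"
          unfolding B_def using q_eq_e goodS unfolding good_def by blast
      next
        fix W assume "openin X W" "e \<in> W"
        then obtain V' where V': "openin X V'" "x \<in> V'" "\<forall>d\<in>V'. \<forall>a\<in>V'. ?q d a \<in> W"
          using quot by blast
        obtain c where "c \<in> D" "c \<in> V" "c \<in> V'"
          using DT[of "V \<inter> V'" x] V V' by blast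
        then obtain n where n: "d n \<in> V" "d n \<in> V'"
          unfolding d_def using from_nat_into_surj[OF \<open>countable D\<close>] by metis
        let ?F = "insert (d n) (\<Union>m\<in>{m. m \<le> n \<and> M m \<subseteq> U}. mul (d n) ` M m \<inter> A)"
        have "finite ?F" using fin[OF d n(1) M]
          by (intro finite.insertI finite_UN_I) auto
        moreover have "infinite (V' \<inter> A)"
          using acc neighborhood_at_openin[OF V'(1,2)] unfolding accumulates_at_def by blast
        ultimately have "\<not> V' \<inter> A \<subseteq> ?F" using finite_subset by blast
        then obtain a where a: "a \<in> V'" "a \<in> A" "a \<notin> ?F" by blast
        then have "good n a" unfolding good_def using n by blast
        then show "W \<inter> B \<noteq> {}" unfolding B_def using V'(3) n a by blast
      qed
      then obtain N where N: "N \<in> \<N>" "N \<subseteq> U" "infinite (N \<inter> B)"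
        using pytE[OF U BS] by blast
      obtain m where m: "M m = N"
        unfolding M_def using from_nat_into_surj[OF \<open>countable \<N>\<close> N(1)] by blast
      \<comment> \<open>A quotient \<open>?q (d n) a\<close> with \<open>n \<ge> m\<close> lies outside \<open>M m\<close> by the choice of \<open>a\<close>.\<close>
      let ?G = "\<Union>n\<in>{n. n < m \<and> d n \<in> V}. ?q (d n) ` (mul (d n) ` N \<inter> A)"
      have "N \<inter> B \<subseteq> ?G"
      proof
        fix b assume "b \<in> N \<inter> B"
        then obtain n a where b: "b \<in> N" "b = ?q (d n) a" and g: "good n a"
          unfolding B_def by blast
        have "a = mul (d n) b"
          using lop_mul_div[OF lop goodS[OF g]] b(2) by simp
        then have a: "a \<in> mul (d n) ` N" using b(1) by blast
        then have "n < m" using g m N(2) unfolding good_def by (meson not_less)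
        then show "b \<in> ?G" using a b(2) g unfolding good_def by blast
      qed
      moreover have "finite ?G" using fin[OF d _ N(1,2)] by auto
      ultimately show False using N(3) finite_subset by blast
    qed
    ultimately show "Pytkeev_network_at X x ?T"
      unfolding Pytkeev_network_at_def by blast
  qed
qed

theorem theorem4p7:
  fixes X :: "'a topology" and mul :: "'a \<Rightarrow> 'a \<Rightarrow> 'a"
  assumes "topological_lop X mul"
    and "t0_space X"
  shows "(\<exists>\<N>. countable \<N> \<and> Pytkeev_network X \<N>) \<longleftrightarrow>
         separable_space X \<and> strong_Pytkeev X"
proof
  assume "\<exists>\<N>. countable \<N> \<and> Pytkeev_network X \<N>"
  then obtain \<N> where N: "countable \<N>" "Pytkeev_network X \<N>" by blast
  then have "separable_space X"
    unfolding Pytkeev_network_def Pytkeev_network_at_def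
    by (blast intro: separable_space_if_countable_network)
  moreover have "strong_Pytkeev X"
    using N unfolding strong_Pytkeev_def Pytkeev_network_def by blast
  ultimately show "separable_space X \<and> strong_Pytkeev X" ..
next
  assume R: "separable_space X \<and> strong_Pytkeev X"
  obtain e where e: "e \<in> topspace X" "\<And>x. x \<in> topspace X \<Longrightarrow> mul x e = x"
    using assms(1) unfolding topological_lop_def lop_def by blast
  obtain D where D: "countable D" "D \<subseteq> topspace X" "X closure_of D = topspace X"
    using R unfolding separable_space_def by blast
  obtain \<N> where N: "countable \<N>" "Pytkeev_network_at X e \<N>"
    using R e(1) unfolding strong_Pytkeev_def by blast
  have "{mul d ` N |d N. d \<in> D \<and> N \<in> \<N>} = (\<lambda>(d, N). mul d ` N) ` (D \<times> \<N>)"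
    by auto
  then have "countable {mul d ` N |d N. d \<in> D \<and> N \<in> \<N>}"
    using D(1) N(1) by simp
  then show "\<exists>\<N>. countable \<N> \<and> Pytkeev_network X \<N>"
    using Pytkeev_network_translates[OF assms(1) topological_lop_t0_imp_t1[OF assms] e N(2,1) D]
    by blast
qed

end
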